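(* Let $k\ge 3$ and let $\alpha>-1/\log_2\left(1-\frac{1}{2^k}\right)$. Then the probability that a random instance $H$ of $k$-QSAT on $N$ qubits at clause density $\alpha$ is unsatisfiable tends to $1$ as $N\to\infty$.
   Context: A random instance of $k$-QSAT on $N$ qubits at clause density $\alpha$ is generated as follows. Each of the $\binom{N}{k}$ possible $k$-element subsets of the $N$ qubits is included as an edge independently with probability $p=\alpha N/\binom{N}{k}$ (for $N$ large enough that $p\le 1$), giving a random hypergraph with edges $I_1,\dots,I_M$ and $\alpha N$ expected edges. Then for each edge $I_m$ a unit vector $|\phi_m\rangle$ in the $2^k$-dimensional Hilbert space of the $k$ qubits in $I_m$ is chosen, independently for different edges and uniformly (Haar measure) on the unit sphere. The instance is the operator $H=\sum_{m=1}^M\Pi^{I_m}_{\phi_m}$ on $(\mathbb{C}^2)^{\otimes N}$, where $\Pi^{I_m}_{\phi_m}$ is $|\phi_m\rangle\langle\phi_m|$ acting on the qubits in $I_m$, tensored with the identity on the remaining qubits. $H$ is satisfiable if $\ker(H)\ne\{0\}$ and unsatisfiable otherwise. *)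

theory Defs
  imports "HOL-Probability.Probability"
begin

text \<open>
  Qubits are labelled by natural numbers.  For a finite set \<open>I\<close> of qubits, the Hilbert space
  of the qubits in \<open>I\<close> is the space of complex functions on the computational basis
  \<open>bits I\<close> of bit strings indexed by \<open>I\<close>.  Bit strings and vectors are extensional functions.
\<close>

definition bits :: "nat set \<Rightarrow> (nat \<Rightarrow> bool) set" where
  "bits I = (\<Pi>\<^sub>E i\<in>I. UNIV)"

type_synonym state = "(nat \<Rightarrow> bool) \<Rightarrow> complex"

definition hilb :: "nat set \<Rightarrow> state set" where
  "hilb I = (\<Pi>\<^sub>E x\<in>bits I. UNIV)"

definition zero_state :: "nat set \<Rightarrow> state" where
  "zero_state I = (\<lambda>x\<in>bits I. 0)"

definition state_norm :: "nat set \<Rightarrow> state \<Rightarrow> real" where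
  "state_norm I \<psi> = L2_set (\<lambda>x. cmod (\<psi> x)) (bits I)"

text \<open>Operators are given by their matrix entries in the computational basis.\<close>

type_synonym operator = "(nat \<Rightarrow> bool) \<Rightarrow> (nat \<Rightarrow> bool) \<Rightarrow> complex"

definition apply_op :: "nat set \<Rightarrow> operator \<Rightarrow> state \<Rightarrow> state" where
  "apply_op I A \<psi> = (\<lambda>x\<in>bits I. \<Sum>y\<in>bits I. A x y * \<psi> y)"

definition op_kernel :: "nat set \<Rightarrow> operator \<Rightarrow> state set" where
  "op_kernel I A = {\<psi> \<in> hilb I. apply_op I A \<psi> = zero_state I}"

definition id_op :: operator where
  "id_op x y = (if x = y then 1 else 0)"

definition rank_one :: "state \<Rightarrow> operator" where
  "rank_one \<phi> x y = \<phi> x * cnj (\<phi> y)"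

text \<open>Tensor product of an operator on the qubits in \<open>I\<close> and one on those in a disjoint set \<open>J\<close>,
  as an operator on the qubits in \<open>I \<union> J\<close>.\<close>

definition tensor_op :: "nat set \<Rightarrow> operator \<Rightarrow> nat set \<Rightarrow> operator \<Rightarrow> operator" where
  "tensor_op I A J B x y =
     A (restrict x I) (restrict y I) * B (restrict x J) (restrict y J)"

definition projector :: "nat \<Rightarrow> nat set \<Rightarrow> state \<Rightarrow> operator" where
  "projector N I \<phi> = tensor_op I (rank_one \<phi>) ({..<N} - I) id_op"

definition hamiltonian :: "nat \<Rightarrow> nat set set \<Rightarrow> (nat set \<Rightarrow> state) \<Rightarrow> operator" where
  "hamiltonian N E \<phi> x y = (\<Sum>I\<in>E. projector N I (\<phi> I) x y)"

definition satisfiable :: "nat \<Rightarrow> operator \<Rightarrow> bool" where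
  "satisfiable N H \<longleftrightarrow> op_kernel {..<N} H \<noteq> {zero_state {..<N}}"

text \<open>
  The uniform (Haar) probability measure on the unit sphere of \<open>hilb I\<close>, as the image of the
  normalised Lebesgue measure on the unit ball under radial projection.
\<close>

definition unit_ball :: "nat set \<Rightarrow> state set" where
  "unit_ball I = {\<psi> \<in> hilb I. state_norm I \<psi> \<le> 1}"

definition normalise :: "nat set \<Rightarrow> state \<Rightarrow> state" where
  "normalise I \<psi> = (\<lambda>x\<in>bits I. \<psi> x / of_real (state_norm I \<psi>))"

definition haar_sphere :: "nat set \<Rightarrow> state measure" where
  "haar_sphere I =
     distr (uniform_measure (\<Pi>\<^sub>M x\<in>bits I. lborel) (unit_ball I))
       (\<Pi>\<^sub>M x\<in>bits I. borel) (normalise I)"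

definition k_subsets :: "nat \<Rightarrow> nat \<Rightarrow> nat set set" where
  "k_subsets k N = {I. I \<subseteq> {..<N} \<and> card I = k}"

text \<open>\<open>bernoulli_pmf p\<close> truncates \<open>p\<close> to \<open>[0, 1]\<close>; this is relevant only for the
  finitely many \<open>N\<close> for which \<open>\<alpha> * N / (N choose k) > 1\<close>.\<close>

definition random_hypergraph :: "nat \<Rightarrow> real \<Rightarrow> nat \<Rightarrow> nat set set pmf" where
  "random_hypergraph k \<alpha> N =
     map_pmf (\<lambda>f. {I \<in> k_subsets k N. f I})
       (Pi_pmf (k_subsets k N) False
         (\<lambda>_. bernoulli_pmf (\<alpha> * real N / real (N choose k))))"

text \<open>
  Vectors are drawn independently for all \<open>k\<close>-subsets, independently of the hypergraph; those
  attached to non-edges do not enter the Hamiltonian.  So, given the edges, the vectors on them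
  are independent and Haar distributed.
\<close>

definition random_instance :: "nat \<Rightarrow> real \<Rightarrow> nat \<Rightarrow> (nat set set \<times> (nat set \<Rightarrow> state)) measure" where
  "random_instance k \<alpha> N =
     measure_pmf (random_hypergraph k \<alpha> N) \<Otimes>\<^sub>M (\<Pi>\<^sub>M I\<in>k_subsets k N. haar_sphere I)"

lemma finite_bits: "finite I \<Longrightarrow> finite (bits I)"
  unfolding bits_def by (intro finite_PiE) auto

lemma bits_nonempty: "bits I \<noteq> {}"
  unfolding bits_def by (simp add: PiE_eq_empty_iff)

lemma finite_k_subsets: "finite (k_subsets k N)"
  unfolding k_subsets_def by (rule finite_subset[of _ "Pow {..<N}"]) auto

lemma state_norm_measurable [measurable]:
  "state_norm I \<in> borel_measurable (\<Pi>\<^sub>M x\<in>bits I. borel)"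
  unfolding state_norm_def L2_set_def by measurable

lemma normalise_measurable [measurable]:
  "normalise I \<in> measurable (\<Pi>\<^sub>M x\<in>bits I. borel) (\<Pi>\<^sub>M x\<in>bits I. borel)"
  unfolding normalise_def by measurable

lemma sets_PiM_lborel_state:
  "sets (\<Pi>\<^sub>M x\<in>B. (lborel :: complex measure)) = sets (\<Pi>\<^sub>M x\<in>B. borel)"
  by (intro sets_PiM_cong) auto

lemma unit_ball_measurable: "unit_ball I \<in> sets (\<Pi>\<^sub>M x\<in>bits I. lborel)"
proof -
  have "unit_ball I = {\<psi> \<in> space (\<Pi>\<^sub>M x\<in>bits I. borel). state_norm I \<psi> \<le> 1}"
    by (auto simp: unit_ball_def hilb_def space_PiM)
  also have "\<dots> \<in> sets (\<Pi>\<^sub>M x\<in>bits I. borel)" by measurable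
  finally show ?thesis by (simp add: sets_PiM_lborel_state)
qed

lemma emeasure_unit_ball:
  assumes "finite I"
  shows "emeasure (\<Pi>\<^sub>M x\<in>bits I. lborel) (unit_ball I) \<noteq> 0"
    and "emeasure (\<Pi>\<^sub>M x\<in>bits I. lborel) (unit_ball I) \<noteq> \<infinity>"
proof -
  interpret product_sigma_finite "\<lambda>x::nat \<Rightarrow> bool. lborel :: complex measure"
    by unfold_locales
  define r where "r = 1 / real (card (bits I))"
  have fin: "finite (bits I)" using assms by (rule finite_bits)
  have c: "card (bits I) > 0" using fin bits_nonempty by (simp add: card_gt_0_iff)
  hence r: "r > 0" by (simp add: r_def)
  have box: "emeasure (\<Pi>\<^sub>M x\<in>bits I. lborel) (\<Pi>\<^sub>E x\<in>bits I. S) =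
      (\<Prod>x\<in>bits I. emeasure lborel S)" if "S \<in> sets borel" for S :: "complex set"
    using that by (intro emeasure_PiM fin) auto
  have "(\<Pi>\<^sub>E x\<in>bits I. cball (0::complex) r) \<subseteq> unit_ball I"
  proof
    fix \<psi> :: state assume a: "\<psi> \<in> (\<Pi>\<^sub>E x\<in>bits I. cball 0 r)"
    have "state_norm I \<psi> \<le> (\<Sum>x\<in>bits I. \<bar>cmod (\<psi> x)\<bar>)"
      unfolding state_norm_def by (rule L2_set_le_sum_abs)
    also have "\<dots> \<le> (\<Sum>x\<in>bits I. r)" using a by (intro sum_mono) (auto simp: PiE_iff)
    also have "\<dots> = 1" using c by (simp add: r_def)
    finally show "\<psi> \<in> unit_ball I" using a by (auto simp: unit_ball_def hilb_def PiE_iff)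
  qed
  hence "(\<Prod>x\<in>bits I. emeasure lborel (cball (0::complex) r))
      \<le> emeasure (\<Pi>\<^sub>M x\<in>bits I. lborel) (unit_ball I)"
    by (subst box[symmetric]) (auto intro!: emeasure_mono unit_ball_measurable)
  moreover have "emeasure lborel (cball (0::complex) r) \<noteq> 0"
  proof -
    have "emeasure lborel (ball (0::complex) r) \<noteq> 0"
      using r emeasure_lborel_ball_finite[of "0::complex" r] content_ball_pos[of r "0::complex"]
      by (auto simp: measure_def)
    moreover have "emeasure lborel (ball (0::complex) r) \<le> emeasure lborel (cball (0::complex) r)"
      by (intro emeasure_mono) auto
    ultimately show ?thesis by auto
  qed
  ultimately show "emeasure (\<Pi>\<^sub>M x\<in>bits I. lborel) (unit_ball I) \<noteq> 0"
    using fin by (auto simp: prod_zero_iff)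
  have "unit_ball I \<subseteq> (\<Pi>\<^sub>E x\<in>bits I. cball (0::complex) 1)"
  proof
    fix \<psi> :: state assume a: "\<psi> \<in> unit_ball I"
    have "cmod (\<psi> x) \<le> 1" if "x \<in> bits I" for x
      using member_le_L2_set[OF fin that, of "\<lambda>x. cmod (\<psi> x)"] a
      by (auto simp: unit_ball_def state_norm_def)
    thus "\<psi> \<in> (\<Pi>\<^sub>E x\<in>bits I. cball (0::complex) 1)"
      using a by (auto simp: unit_ball_def hilb_def PiE_iff)
  qed
  hence "emeasure (\<Pi>\<^sub>M x\<in>bits I. lborel) (unit_ball I)
     \<le> (\<Prod>x\<in>bits I. emeasure lborel (cball (0::complex) 1))"
    by (subst box[symmetric]) (auto intro!: emeasure_mono sets_PiM_I_finite fin)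
  also have "\<dots> < \<infinity>"
    using emeasure_lborel_cball_finite[of "0::complex" 1]
    by (simp add: less_top[symmetric] power_eq_top_ennreal)
  finally show "emeasure (\<Pi>\<^sub>M x\<in>bits I. lborel) (unit_ball I) \<noteq> \<infinity>" by simp
qed

lemma prob_space_haar_sphere:
  assumes "finite I"
  shows "prob_space (haar_sphere I)"
  unfolding haar_sphere_def
proof (rule prob_space.prob_space_distr)
  show "prob_space (uniform_measure (\<Pi>\<^sub>M x\<in>bits I. lborel) (unit_ball I))"
    by (intro prob_space_uniform_measure emeasure_unit_ball assms)
  have "sets (uniform_measure (\<Pi>\<^sub>M x\<in>bits I. lborel) (unit_ball I))
      = sets (\<Pi>\<^sub>M x\<in>bits I. (borel :: complex measure))"
    by (simp add: sets_PiM_lborel_state)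
  thus "normalise I \<in> uniform_measure (\<Pi>\<^sub>M x\<in>bits I. lborel) (unit_ball I)
      \<rightarrow>\<^sub>M (\<Pi>\<^sub>M x\<in>bits I. borel)"
    using normalise_measurable measurable_cong_sets by blast
qed

lemma prob_space_random_instance: "prob_space (random_instance k \<alpha> N)"
proof -
  have "prob_space (\<Pi>\<^sub>M I\<in>k_subsets k N. haar_sphere I)"
    by (intro prob_space_PiM prob_space_haar_sphere)
      (auto simp: k_subsets_def intro: finite_subset)
  thus ?thesis unfolding random_instance_def
    by (intro prob_space_pair) (simp_all add: prob_space_measure_pmf)
qed

end

(*
  If K is a subspace and phi_1, ..., phi_(2^k) is a basis of the qubits of an edge, some
  <phi_i| cuts the dimension of K by a factor of at least 1 - 1/2^k, since the contractions with
  all of them have no common kernel.  Used with computational basis vectors only, this is the greedy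
  construction of an unsatisfiable classical k-SAT formula on any hypergraph with
  2^N (1 - 1/2^k)^M < 1.  Picking for every assignment x a clause violated by x gives a square
  subsystem of the linear equations <phi_I|psi> = 0 that is the identity matrix at the classical
  instance.  Its determinant is a nonzero polynomial in the conjugated entries of the vectors, and so
  is nonzero almost surely: every such hypergraph is almost surely unsatisfiable.  The number of edges
  is binomial with mean alpha N, and a Chernoff bound shows that 2^N (1 - 1/2^k)^M < 1 fails with
  exponentially small probability.
*)

theory Submission
  imports Defs "Jordan_Normal_Form.Determinant" "HOL-Real_Asymp.Real_Asymp"
begin

section \<open>Determinants of matrices indexed by a finite set\<close>

definition enum_of :: "'a set \<Rightarrow> nat \<Rightarrow> 'a" where
  "enum_of B = (SOME h. bij_betw h {0..<card B} B)"

lemma bij_betw_enum_of: "finite B \<Longrightarrow> bij_betw (enum_of B) {0..<card B} B"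
  unfolding enum_of_def by (rule someI_ex[OF ex_bij_betw_nat_finite])

text \<open>For finite \<open>B\<close> the value does not depend on the enumeration: it orders rows
  and columns alike, so changing it conjugates the matrix by a permutation.\<close>

definition matrix_det :: "'a set \<Rightarrow> ('a \<Rightarrow> 'a \<Rightarrow> 'b::field) \<Rightarrow> 'b" where
  "matrix_det B A = Determinant.det (Matrix.mat (card B) (card B)
     (\<lambda>(i, j). A (enum_of B i) (enum_of B j)))"

lemma matrix_det_expand:
  "matrix_det B A = (\<Sum>p\<in>{p. p permutes {0..<card B}}.
     signof p * (\<Prod>i=0..<card B. A (enum_of B i) (enum_of B (p i))))"
proof -
  have "p i < n" if "p permutes {0..<n}" "i < n" for p and i n :: nat
    using permutes_in_image[OF that(1), of i] that(2) by simp
  then show ?thesis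
    unfolding matrix_det_def Determinant.det_def by (auto intro!: sum.cong prod.cong)
qed

lemma matrix_det_eq_0_iff:
  assumes "finite B"
  shows "matrix_det B A = 0 \<longleftrightarrow>
    (\<exists>v. (\<exists>x\<in>B. v x \<noteq> 0) \<and> (\<forall>x\<in>B. (\<Sum>y\<in>B. A x y * v y) = 0))"
proof -
  define n where "n = card B"
  define e where "e = enum_of B"
  define M where "M = Matrix.mat n n (\<lambda>(i, j). A (e i) (e j))"
  have e: "bij_betw e {0..<n} B" unfolding e_def n_def by (rule bij_betw_enum_of[OF assms])
  have M: "M \<in> carrier_mat n n" by (simp add: M_def)
  have mult: "vec_index (M *\<^sub>v Matrix.vec n (\<lambda>i. v (e i))) i = (\<Sum>y\<in>B. A (e i) y * v y)"
    if "i < n" for v i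
  proof -
    have "vec_index (M *\<^sub>v Matrix.vec n (\<lambda>i. v (e i))) i = (\<Sum>j=0..<n. A (e i) (e j) * v (e j))"
      using that by (simp add: M_def scalar_prod_def)
    also have "\<dots> = (\<Sum>y\<in>B. A (e i) y * v y)"
      by (rule sum.reindex_bij_betw[OF e])
    finally show ?thesis .
  qed
  have "matrix_det B A = 0 \<longleftrightarrow>
      (\<exists>v. v \<in> carrier_vec n \<and> v \<noteq> 0\<^sub>v n \<and> M *\<^sub>v v = 0\<^sub>v n)"
    using det_0_iff_vec_prod_zero_field[OF M] by (simp add: matrix_det_def M_def n_def e_def)
  also have "\<dots> \<longleftrightarrow> (\<exists>v. (\<exists>x\<in>B. v x \<noteq> 0) \<and> (\<forall>x\<in>B. (\<Sum>y\<in>B. A x y * v y) = 0))"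
  proof (intro iffI; elim exE conjE)
    fix v assume v: "v \<in> carrier_vec n" "v \<noteq> 0\<^sub>v n" "M *\<^sub>v v = 0\<^sub>v n"
    define w where "w x = vec_index v (the_inv_into {0..<n} e x)" for x
    have w: "w (e i) = vec_index v i" if "i < n" for i
      using that e by (simp add: w_def the_inv_into_f_f bij_betw_def)
    have vw: "v = Matrix.vec n (\<lambda>i. w (e i))" using v(1) w by (intro eq_vecI) auto
    from v(1,2) obtain i where i: "i < n" "vec_index v i \<noteq> 0"
      by (metis carrier_vecD eq_vecI index_zero_vec)
    have "\<exists>x\<in>B. w x \<noteq> 0"
      using i w[of i] bij_betwE[OF e] by (intro bexI[of _ "e i"]) auto
    moreover have "(\<Sum>y\<in>B. A x y * w y) = 0" if "x \<in> B" for x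
    proof -
      from that e obtain i where "i < n" "x = e i"
        by (auto simp: bij_betw_def)
      with mult[of i w] v(3) vw show ?thesis by simp
    qed
    ultimately show "\<exists>v. (\<exists>x\<in>B. v x \<noteq> 0) \<and> (\<forall>x\<in>B. (\<Sum>y\<in>B. A x y * v y) = 0)" by blast
  next
    fix v assume v: "\<exists>x\<in>B. v x \<noteq> 0" "\<forall>x\<in>B. (\<Sum>y\<in>B. A x y * v y) = 0"
    let ?w = "Matrix.vec n (\<lambda>i. v (e i))"
    from v(1) e obtain i where i: "i < n" "v (e i) \<noteq> 0"
      by (auto simp: bij_betw_def)
    then have "vec_index ?w i \<noteq> 0" by simp
    with i have "?w \<noteq> 0\<^sub>v n" by (metis index_zero_vec(1))
    moreover have "M *\<^sub>v ?w = 0\<^sub>v n"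
      using v(2) mult[of _ v] bij_betwE[OF e] M by (intro eq_vecI) (auto simp: M_def)
    ultimately show "\<exists>v. v \<in> carrier_vec n \<and> v \<noteq> 0\<^sub>v n \<and> M *\<^sub>v v = 0\<^sub>v n"
      by (intro exI[of _ ?w]) simp
  qed
  finally show ?thesis .
qed

text \<open>Nonzero row factors leave the kernel unchanged. In
  \<open>constraint_det_normalise\<close> this makes radial projection harmless.\<close>

lemma matrix_det_scale_rows_eq_0_iff:
  assumes "finite B" "\<And>x. x \<in> B \<Longrightarrow> d x \<noteq> 0"
  shows "matrix_det B (\<lambda>x y. d x * A x y) = 0 \<longleftrightarrow> matrix_det B A = 0"
proof -
  have "(\<Sum>y\<in>B. d x * A x y * v y) = d x * (\<Sum>y\<in>B. A x y * v y)" for x v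
    by (simp add: sum_distrib_left mult.assoc)
  then show ?thesis using assms by (simp add: matrix_det_eq_0_iff)
qed

lemma matrix_det_cong:
  assumes "finite B" "\<And>x y. x \<in> B \<Longrightarrow> y \<in> B \<Longrightarrow> A x y = A' x y"
  shows "matrix_det B A = matrix_det B A'"
proof -
  have "A (enum_of B i) (enum_of B j) = A' (enum_of B i) (enum_of B j)"
    if "i < card B" "j < card B" for i j
    using that bij_betwE[OF bij_betw_enum_of[OF assms(1)]] by (intro assms(2)) auto
  then show ?thesis
    unfolding matrix_det_def by (intro arg_cong[of _ _ Determinant.det] eq_matI) auto
qed

lemma borel_measurable_matrix_det:
  fixes A :: "'w \<Rightarrow> 'a \<Rightarrow> 'a \<Rightarrow> complex"
  assumes "finite B" "\<And>x y. x \<in> B \<Longrightarrow> y \<in> B \<Longrightarrow> (\<lambda>w. A w x y) \<in> borel_measurable M"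
  shows "(\<lambda>w. matrix_det B (A w)) \<in> borel_measurable M"
proof -
  have "enum_of B i \<in> B" if "i < card B" for i
    using that bij_betwE[OF bij_betw_enum_of[OF assms(1)]] by auto
  moreover have "p i < n" if "p permutes {0..<n}" "i < n" for p and i n :: nat
    using permutes_in_image[OF that(1), of i] that(2) by simp
  ultimately show ?thesis
    unfolding matrix_det_expand
    by (intro borel_measurable_sum borel_measurable_times borel_measurable_prod
        borel_measurable_const assms(2)) auto
qed

text \<open>By the Leibniz expansion. One parameter suffices because a single amplitude is varied at
  a time.\<close>

lemma matrix_det_polynomial:
  fixes A :: "'b::field \<Rightarrow> 'a \<Rightarrow> 'a \<Rightarrow> 'b"
  assumes "\<And>x y. \<exists>p. \<forall>z. A z x y = poly p z"
  shows "\<exists>p. \<forall>z. matrix_det B (A z) = poly p z"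
proof -
  obtain q where q: "\<And>x y z. A z x y = poly (q x y) z" using assms by metis
  show ?thesis
    unfolding matrix_det_expand q
    by (intro exI[of _ "\<Sum>p\<in>{p. p permutes {0..<card B}}.
          [:signof p:] * (\<Prod>i=0..<card B. q (enum_of B i) (enum_of B (p i)))"])
      (simp add: poly_sum poly_prod)
qed

section \<open>Kernel of the Hamiltonian and contractions\<close>

text \<open>The amplitude at the basis state \<open>r\<close> of the remaining qubits of the partial inner product
  \<open>\<langle>\<phi>|\<psi>\<rangle>\<close> over the qubits in \<open>I\<close>.\<close>

definition contraction :: "nat \<Rightarrow> nat set \<Rightarrow> state \<Rightarrow> (nat \<Rightarrow> bool) \<Rightarrow> state \<Rightarrow> complex" where
  "contraction N I \<phi> r \<psi> =
     (\<Sum>y | y \<in> bits {..<N} \<and> restrict y ({..<N} - I) = r. cnj (\<phi> (restrict y I)) * \<psi> y)"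

lemma finite_bits_lessThan [simp]: "finite (bits {..<N::nat})"
  by (simp add: finite_bits)

lemma restrict_in_bits [simp]: "restrict x I \<in> bits I"
  by (simp add: bits_def)

text \<open>The identity factor of a projector keeps only the \<open>y\<close> that agree with
  \<open>x\<close> outside \<open>I\<close>; summing over them gives a contraction.\<close>

lemma apply_hamiltonian:
  "(\<Sum>y\<in>bits {..<N}. hamiltonian N E \<phi> x y * \<psi> y) =
    (\<Sum>I\<in>E. \<phi> I (restrict x I) * contraction N I (\<phi> I) (restrict x ({..<N} - I)) \<psi>)"
proof -
  have "(\<Sum>y\<in>bits {..<N}. projector N I (\<phi> I) x y * \<psi> y) =
      \<phi> I (restrict x I) * contraction N I (\<phi> I) (restrict x ({..<N} - I)) \<psi>" for I
    unfolding contraction_def sum_distrib_left sum.inter_filter[OF finite_bits_lessThan]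
    by (intro sum.cong) (auto simp: projector_def tensor_op_def rank_one_def id_op_def)
  moreover have "(\<Sum>y\<in>bits {..<N}. hamiltonian N E \<phi> x y * \<psi> y) =
      (\<Sum>I\<in>E. \<Sum>y\<in>bits {..<N}. projector N I (\<phi> I) x y * \<psi> y)"
    unfolding hamiltonian_def sum_distrib_right by (rule sum.swap)
  ultimately show ?thesis by simp
qed

text \<open>The left-hand side is \<open>\<langle>\<psi>|H|\<psi>\<rangle>\<close>, so a state in the kernel has vanishing contractions.\<close>

lemma energy_eq_sum_contractions:
  "(\<Sum>x\<in>bits {..<N}. cnj (\<psi> x) * (\<Sum>y\<in>bits {..<N}. hamiltonian N E \<phi> x y * \<psi> y)) =
    of_real (\<Sum>I\<in>E. \<Sum>r\<in>bits ({..<N} - I). (cmod (contraction N I (\<phi> I) r \<psi>))\<^sup>2)"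
proof -
  have "(\<Sum>x\<in>bits {..<N}. cnj (\<psi> x) * (\<phi> I (restrict x I) *
        contraction N I (\<phi> I) (restrict x ({..<N} - I)) \<psi>)) =
      (\<Sum>r\<in>bits ({..<N} - I). of_real ((cmod (contraction N I (\<phi> I) r \<psi>))\<^sup>2))" (is "?l = _") for I
  proof -
    let ?J = "{..<N} - I"
    \<comment> \<open>Group the \<open>x\<close> by their restriction off \<open>I\<close>. The
      contraction is constant on each class, and the remaining sum over the class is its
      conjugate.\<close>
    have "?l = (\<Sum>r\<in>bits ?J. \<Sum>x | x \<in> bits {..<N} \<and> restrict x ?J = r.
        cnj (\<psi> x) * (\<phi> I (restrict x I) * contraction N I (\<phi> I) (restrict x ?J) \<psi>))"
      by (rule sum.group[symmetric]) (auto simp: finite_bits)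
    also have "\<dots> = (\<Sum>r\<in>bits ?J. contraction N I (\<phi> I) r \<psi> * cnj (contraction N I (\<phi> I) r \<psi>))"
    proof (intro sum.cong refl)
      fix r
      have "(\<Sum>x | x \<in> bits {..<N} \<and> restrict x ?J = r.
          cnj (\<psi> x) * (\<phi> I (restrict x I) * contraction N I (\<phi> I) (restrict x ?J) \<psi>)) =
        (\<Sum>x | x \<in> bits {..<N} \<and> restrict x ?J = r.
          contraction N I (\<phi> I) r \<psi> * (\<phi> I (restrict x I) * cnj (\<psi> x)))"
        by (intro sum.cong) auto
      then show "(\<Sum>x | x \<in> bits {..<N} \<and> restrict x ?J = r.
          cnj (\<psi> x) * (\<phi> I (restrict x I) * contraction N I (\<phi> I) (restrict x ?J) \<psi>)) =
          contraction N I (\<phi> I) r \<psi> * cnj (contraction N I (\<phi> I) r \<psi>)"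
        by (simp add: sum_distrib_left[symmetric] contraction_def)
    qed
    finally show ?thesis by (simp only: complex_norm_square)
  qed
  moreover have "(\<Sum>x\<in>bits {..<N}. cnj (\<psi> x) * (\<Sum>y\<in>bits {..<N}. hamiltonian N E \<phi> x y * \<psi> y)) =
      (\<Sum>I\<in>E. \<Sum>x\<in>bits {..<N}. cnj (\<psi> x) * (\<phi> I (restrict x I) *
        contraction N I (\<phi> I) (restrict x ({..<N} - I)) \<psi>))"
    unfolding apply_hamiltonian sum_distrib_left by (rule sum.swap)
  ultimately show ?thesis by (simp only: of_real_sum)
qed

lemma satisfiable_iff:
  "satisfiable N H \<longleftrightarrow> (\<exists>\<psi>. (\<exists>x\<in>bits {..<N}. \<psi> x \<noteq> 0) \<and>
     (\<forall>x\<in>bits {..<N}. (\<Sum>y\<in>bits {..<N}. H x y * \<psi> y) = 0))" (is "_ \<longleftrightarrow> (\<exists>\<psi>. ?P \<psi>)")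
proof
  let ?B = "bits {..<N}"
  have "zero_state {..<N} \<in> op_kernel {..<N} H"
    by (auto simp: op_kernel_def zero_state_def hilb_def apply_op_def restrict_def fun_eq_iff)
  moreover assume "satisfiable N H"
  ultimately obtain \<psi> where \<psi>: "\<psi> \<in> op_kernel {..<N} H" "\<psi> \<noteq> zero_state {..<N}"
    unfolding satisfiable_def by blast
  have "\<psi> \<in> extensional ?B" using \<psi>(1) by (simp add: op_kernel_def hilb_def PiE_iff)
  then have "\<exists>x\<in>?B. \<psi> x \<noteq> 0"
    using \<psi>(2) extensionalityI[of \<psi> ?B "zero_state {..<N}"] by (auto simp: zero_state_def)
  moreover have "(\<Sum>y\<in>?B. H x y * \<psi> y) = 0" if "x \<in> ?B" for x
  proof -
    have "apply_op {..<N} H \<psi> x = zero_state {..<N} x" using \<psi>(1) by (simp add: op_kernel_def)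
    then show ?thesis using that by (simp add: apply_op_def zero_state_def)
  qed
  ultimately show "\<exists>\<psi>. ?P \<psi>" by blast
next
  let ?B = "bits {..<N}"
  assume "\<exists>\<psi>. ?P \<psi>"
  then obtain \<psi> x where \<psi>: "?P \<psi>" and x: "x \<in> ?B" "\<psi> x \<noteq> 0" by blast
  have "restrict \<psi> ?B \<in> op_kernel {..<N} H"
    using \<psi> by (auto simp: op_kernel_def hilb_def apply_op_def zero_state_def fun_eq_iff)
  moreover have "restrict \<psi> ?B \<noteq> zero_state {..<N}"
    using x by (auto simp: zero_state_def fun_eq_iff)
  ultimately show "satisfiable N H" unfolding satisfiable_def by blast
qed

text \<open>Trades the quantifier over states for a polynomial condition on the entries of
  \<open>H\<close>, from which measurability follows.\<close>

lemma satisfiable_iff_matrix_det: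
  "satisfiable N H \<longleftrightarrow> matrix_det (bits {..<N}) H = 0"
  by (simp add: satisfiable_iff matrix_det_eq_0_iff)

lemma satisfiable_hamiltonian_contractions:
  assumes "finite E" "satisfiable N (hamiltonian N E \<phi>)"
  shows "\<exists>\<psi>. (\<exists>x\<in>bits {..<N}. \<psi> x \<noteq> 0) \<and>
    (\<forall>I\<in>E. \<forall>r\<in>bits ({..<N} - I). contraction N I (\<phi> I) r \<psi> = 0)"
proof -
  obtain \<psi> where \<psi>: "\<exists>x\<in>bits {..<N}. \<psi> x \<noteq> 0"
    "\<forall>x\<in>bits {..<N}. (\<Sum>y\<in>bits {..<N}. hamiltonian N E \<phi> x y * \<psi> y) = 0"
    using assms(2) unfolding satisfiable_iff by blast
  have "(\<Sum>x\<in>bits {..<N}. cnj (\<psi> x) * (\<Sum>y\<in>bits {..<N}. hamiltonian N E \<phi> x y * \<psi> y)) = 0"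
    using \<psi>(2) by simp
  then have "(\<Sum>I\<in>E. \<Sum>r\<in>bits ({..<N} - I). (cmod (contraction N I (\<phi> I) r \<psi>))\<^sup>2) = 0"
    unfolding energy_eq_sum_contractions of_real_eq_0_iff .
  then have "\<forall>I\<in>E. \<forall>r\<in>bits ({..<N} - I). contraction N I (\<phi> I) r \<psi> = 0"
    using assms(1) by (simp add: sum_nonneg_eq_0_iff sum_nonneg finite_bits)
  with \<psi>(1) show ?thesis by blast
qed

text \<open>A set of rows of the linear system \<open>contraction N I (\<phi> I) r \<psi> = 0\<close>, one for each \<open>x\<close>, where
  \<open>c x\<close> is the chosen edge and \<open>r\<close> the restriction of \<open>x\<close>.\<close>

definition constraint_matrix ::
    "nat \<Rightarrow> ((nat \<Rightarrow> bool) \<Rightarrow> nat set) \<Rightarrow> (nat set \<Rightarrow> state) \<Rightarrow> operator" where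
  "constraint_matrix N c \<phi> x y =
     (if restrict y ({..<N} - c x) = restrict x ({..<N} - c x)
      then cnj (\<phi> (c x) (restrict y (c x))) else 0)"

text \<open>A kernel vector solves every contraction equation, in particular the square subsystem
  selected by \<open>c\<close>; a nonzero determinant leaves that subsystem only the zero
  solution.\<close>

lemma unsatisfiable_if_constraint_det:
  assumes "finite E" "\<And>x. x \<in> bits {..<N} \<Longrightarrow> c x \<in> E"
    and "matrix_det (bits {..<N}) (constraint_matrix N c \<phi>) \<noteq> 0"
  shows "\<not> satisfiable N (hamiltonian N E \<phi>)"
proof
  assume "satisfiable N (hamiltonian N E \<phi>)"
  then obtain \<psi> where \<psi>: "\<exists>x\<in>bits {..<N}. \<psi> x \<noteq> 0"
    "\<forall>I\<in>E. \<forall>r\<in>bits ({..<N} - I). contraction N I (\<phi> I) r \<psi> = 0"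
    using satisfiable_hamiltonian_contractions[OF assms(1)] by blast
  have "(\<Sum>y\<in>bits {..<N}. constraint_matrix N c \<phi> x y * \<psi> y) =
      contraction N (c x) (\<phi> (c x)) (restrict x ({..<N} - c x)) \<psi>" for x
    unfolding contraction_def sum.inter_filter[OF finite_bits_lessThan]
    by (intro sum.cong) (auto simp: constraint_matrix_def)
  then have "\<forall>x\<in>bits {..<N}. (\<Sum>y\<in>bits {..<N}. constraint_matrix N c \<phi> x y * \<psi> y) = 0"
    using \<psi>(2) assms(2) by simp
  then show False using \<psi>(1) assms(3) by (auto simp: matrix_det_eq_0_iff)
qed

section \<open>Unsatisfiable classical instances on a given hypergraph\<close>

lemma card_bits: "finite I \<Longrightarrow> card (bits I) = 2 ^ card I"
  by (simp add: bits_def card_PiE)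

text \<open>Greedy construction of an unsatisfiable classical instance: by pigeonhole, some clause on
  \<open>I\<close> is violated by at least a fraction \<open>2 ^ -k\<close> of the remaining assignments.\<close>

lemma exists_clauses_few_solutions:
  assumes "finite E" "\<And>I. I \<in> E \<Longrightarrow> finite I \<and> card I = k"
  shows "\<exists>a. (\<forall>I\<in>E. a I \<in> bits I) \<and>
    real (card {x \<in> bits {..<N}. \<forall>I\<in>E. restrict x I \<noteq> a I}) \<le> 2 ^ N * (1 - 1 / 2 ^ k) ^ card E"
  using assms
proof (induction E rule: finite_induct)
  case empty
  then show ?case by (simp add: card_bits)
next
  case (insert I E)
  obtain a where a: "\<forall>I\<in>E. a I \<in> bits I"
    "real (card {x \<in> bits {..<N}. \<forall>I\<in>E. restrict x I \<noteq> a I}) \<le> 2 ^ N * (1 - 1 / 2 ^ k) ^ card E"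
    using insert.IH insert.prems by blast
  have I: "finite I" "card I = k" using insert.prems[of I] by auto
  define S where "S = {x \<in> bits {..<N}. \<forall>I\<in>E. restrict x I \<noteq> a I}"
  have S: "finite S" by (simp add: S_def)
  let ?v = "\<lambda>b. {x \<in> S. restrict x I = b}"
  have "\<exists>b\<in>bits I. real (card S) / 2 ^ k \<le> real (card (?v b))"
  proof (rule ccontr)
    assume "\<not> ?thesis"
    then have "(\<Sum>b\<in>bits I. real (card (?v b))) < (\<Sum>b\<in>bits I. real (card S) / 2 ^ k)"
      using I bits_nonempty by (intro sum_strict_mono) (auto simp: finite_bits)
    also have "\<dots> = real (card S)" using I by (simp add: card_bits)
    also have "\<dots> = (\<Sum>b\<in>bits I. real (card (?v b)))"
      using sum.group[of S "bits I" "\<lambda>x. restrict x I" "\<lambda>_. 1::nat"] S I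
      by (simp add: finite_bits image_subset_iff flip: of_nat_sum)
    finally show False by simp
  qed
  then obtain b where b: "b \<in> bits I" "real (card S) / 2 ^ k \<le> real (card (?v b))" by blast
  \<comment> \<open>As \<open>I\<close> is not in \<open>E\<close>, redefining \<open>a\<close> at
    \<open>I\<close> keeps the earlier clauses.\<close>
  have *: "{x \<in> bits {..<N}. \<forall>J\<in>insert I E. restrict x J \<noteq> (a(I := b)) J} = S - ?v b"
    using insert.hyps(2) by (auto simp: S_def)
  have "real (card (S - ?v b)) = real (card S) - real (card (?v b))"
    using S by (subst card_Diff_subset) (auto intro!: of_nat_diff card_mono)
  also have "\<dots> \<le> real (card S) * (1 - 1 / 2 ^ k)" using b(2) by (simp add: algebra_simps)
  also have "\<dots> \<le> 2 ^ N * (1 - 1 / 2 ^ k) ^ card E * (1 - 1 / 2 ^ k)"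
    using a(2) by (intro mult_right_mono) (auto simp: S_def)
  also have "\<dots> = 2 ^ N * (1 - 1 / 2 ^ k) ^ card (insert I E)"
    using insert.hyps by simp
  finally have "real (card {x \<in> bits {..<N}. \<forall>J\<in>insert I E. restrict x J \<noteq> (a(I := b)) J})
      \<le> 2 ^ N * (1 - 1 / 2 ^ k) ^ card (insert I E)"
    unfolding * .
  moreover have "\<forall>J\<in>insert I E. (a(I := b)) J \<in> bits J"
    using a(1) b(1) by simp
  ultimately show ?case by blast
qed

lemma exists_nonsingular_constraints:
  assumes "finite E" "\<And>I. I \<in> E \<Longrightarrow> finite I \<and> card I = k" "2 ^ N * (1 - 1 / 2 ^ k) ^ card E < (1::real)"
  shows "\<exists>c a. (\<forall>x\<in>bits {..<N}. c x \<in> E) \<and>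
    matrix_det (bits {..<N}) (constraint_matrix N c (\<lambda>I b. if b = a I then 1 else 0)) \<noteq> 0"
proof -
  obtain a where "real (card {x \<in> bits {..<N}. \<forall>I\<in>E. restrict x I \<noteq> a I}) \<le> 2 ^ N * (1 - 1 / 2 ^ k) ^ card E"
    using exists_clauses_few_solutions[OF assms(1,2), of N] by blast
  also note assms(3)
  \<comment> \<open>A cardinality below 1 is 0, so every assignment violates some clause;
    \<open>c\<close> picks one.\<close>
  finally have "card {x \<in> bits {..<N}. \<forall>I\<in>E. restrict x I \<noteq> a I} = 0" by simp
  then have "\<forall>x\<in>bits {..<N}. \<exists>I. I \<in> E \<and> restrict x I = a I" by auto
  then obtain c where c: "\<forall>x\<in>bits {..<N}. c x \<in> E \<and> restrict x (c x) = a (c x)" by metis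
  let ?A = "constraint_matrix N c (\<lambda>I b. if b = a I then 1 else 0)"
  \<comment> \<open>A nonzero entry forces \<open>y\<close> to agree with \<open>x\<close> outside
    \<open>c x\<close>, and with \<open>a (c x)\<close>, hence again with \<open>x\<close>, inside.
    So the matrix is the identity.\<close>
  have A: "?A x y = (if y = x then 1 else 0)" if "x \<in> bits {..<N}" "y \<in> bits {..<N}" for x y
  proof -
    have "y = x" if "restrict y ({..<N} - c x) = restrict x ({..<N} - c x)"
      "restrict y (c x) = restrict x (c x)"
    proof (rule PiE_ext)
      show "y \<in> (\<Pi>\<^sub>E i\<in>{..<N}. UNIV)" "x \<in> (\<Pi>\<^sub>E i\<in>{..<N}. UNIV)"
        using \<open>x \<in> _\<close> \<open>y \<in> _\<close> by (auto simp: bits_def)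
      show "y i = x i" if "i \<in> {..<N}" for i
        using fun_cong[OF \<open>restrict y (c x) = _\<close>, of i]
          fun_cong[OF \<open>restrict y ({..<N} - c x) = _\<close>, of i] that
        by (cases "i \<in> c x") auto
    qed
    then show ?thesis using c that by (auto simp: constraint_matrix_def)
  qed
  have "(\<Sum>y\<in>bits {..<N}. ?A x y * v y) = v x" if "x \<in> bits {..<N}" for x v
    using that by (simp add: A if_distrib[of "\<lambda>z. z * _"] sum.delta cong: sum.cong if_cong)
  then have "matrix_det (bits {..<N}) ?A \<noteq> 0" by (auto simp: matrix_det_eq_0_iff)
  with c show ?thesis by blast
qed

section \<open>Generic vectors\<close>

text \<open>Stands in for the fact that a nonzero polynomial in several variables vanishes only on a
  null set: one good point and good behaviour in each single coordinate suffice. First move the new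
  coordinate of \<open>x0\<close>; for almost every value \<open>z\<close> the point stays good, so
  the induction hypothesis applies to the slice at \<open>z\<close>, and Fubini combines the slices.
  It is used twice, over the amplitudes of one vector and over the edges.\<close>

lemma (in product_sigma_finite) AE_PiM_coordinatewise:
  assumes "finite I" "Measurable.pred (PiM I M) P" "x0 \<in> space (PiM I M)" "P x0"
    and "\<And>i x. i \<in> I \<Longrightarrow> x \<in> space (PiM I M) \<Longrightarrow> P x \<Longrightarrow> AE z in M i. P (x(i := z))"
  shows "AE x in PiM I M. P x"
  using assms
proof (induction I arbitrary: P x0 rule: finite_induct)
  case empty
  then show ?case by (auto intro!: AE_I2 simp: space_PiM)
next
  case (insert i I)
  note P [measurable] = insert.prems(1)
  have upd: "x(i := z) \<in> space (PiM (insert i I) M)"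
    if "x \<in> space (PiM I M)" "z \<in> space (M i)" for x z
    using that by (auto simp: space_PiM PiE_iff extensional_def)
  \<comment> \<open>Indicator of the bad set; the goal is that its integral is 0.\<close>
  let ?f = "\<lambda>x. indicator {x. \<not> P x} x :: ennreal"
  have slice: "AE x in PiM I M. P (x(i := z))" if z: "z \<in> space (M i)" "P (x0(i := z))" for z
  proof (rule insert.IH)
    show "Measurable.pred (PiM I M) (\<lambda>x. P (x(i := z)))"
      using z(1) by measurable
    show "restrict x0 I \<in> space (PiM I M)"
      using insert.prems(2) by (auto simp: space_PiM PiE_iff)
    have "(restrict x0 I)(i := z) = x0(i := z)"
      using insert.prems(2) by (auto simp: space_PiM PiE_iff extensional_def)
    then show "P ((restrict x0 I)(i := z))" using z(2) by simp
    fix j x assume j: "j \<in> I" "x \<in> space (PiM I M)" "P (x(i := z))"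
    then have "AE w in M j. P ((x(i := z))(j := w))"
      using z(1) by (intro insert.prems(4)) (simp_all only: upd insert_iff simp_thms)
    moreover have "i \<noteq> j" using j(1) insert.hyps(2) by auto
    ultimately show "AE w in M j. P ((x(j := w))(i := z))"
      by (simp add: fun_upd_twist)
  qed
  have "AE z in M i. P (x0(i := z))"
    using insert.prems by (intro insert.prems(4)) auto
  then have "AE z in M i. (\<integral>\<^sup>+ x. ?f (x(i := z)) \<partial>PiM I M) = 0"
  proof (rule AE_mp, intro AE_I2 impI)
    fix z assume z: "z \<in> space (M i)" "P (x0(i := z))"
    have "AE x in PiM I M. ?f (x(i := z)) = 0"
      using slice[OF z] by (rule AE_mp) (auto intro!: AE_I2)
    then show "(\<integral>\<^sup>+ x. ?f (x(i := z)) \<partial>PiM I M) = 0"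
      by (subst nn_integral_cong_AE[where v = "\<lambda>_. 0"]) auto
  qed
  then have "(\<integral>\<^sup>+ z. (\<integral>\<^sup>+ x. ?f (x(i := z)) \<partial>PiM I M) \<partial>M i) = 0"
    by (subst nn_integral_cong_AE[where v = "\<lambda>_. 0"]) auto
  moreover have f: "?f \<in> borel_measurable (PiM (insert i I) M)" by measurable
  ultimately have "(\<integral>\<^sup>+ x. ?f x \<partial>PiM (insert i I) M) = 0"
    using insert.hyps by (subst product_nn_integral_insert_rev) auto
  then have "AE x in PiM (insert i I) M. ?f x = 0"
    using f by (simp add: nn_integral_0_iff_AE)
  then show ?case by (rule AE_mp) (auto intro!: AE_I2 simp: indicator_def split: if_splits)
qed

section \<open>Nonvanishing of the constraint determinant for random vectors\<close>

lemma AE_lborel_poly_cnj_nonzero: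
  fixes p :: "complex poly"
  assumes "p \<noteq> 0"
  shows "AE z in lborel. poly p (cnj z) \<noteq> 0"
proof -
  have "{z. poly p (cnj z) = 0} \<subseteq> cnj ` {z. poly p z = 0}"
    by (auto intro!: image_eqI[where x = "cnj z" for z])
  then have "finite {z. poly p (cnj z) = 0}"
    using poly_roots_finite[OF assms] finite_surj by blast
  then have "{z. poly p (cnj z) = 0} \<in> null_sets lborel"
    by (rule finite_imp_null_set_lborel)
  then show ?thesis by (rule AE_I') auto
qed

lemma borel_measurable_cnj:
  fixes f :: "'a \<Rightarrow> complex"
  assumes "f \<in> borel_measurable M"
  shows "(\<lambda>w. cnj (f w)) \<in> borel_measurable M"
  by (rule measurable_compose[OF assms borel_measurable_continuous_onI]) (intro continuous_intros)

lemma borel_measurable_constraint_det: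
  assumes "\<And>x b. x \<in> bits {..<N} \<Longrightarrow> b \<in> bits (c x) \<Longrightarrow> (\<lambda>w. \<phi> w (c x) b) \<in> borel_measurable M"
  shows "(\<lambda>w. matrix_det (bits {..<N}) (constraint_matrix N c (\<phi> w))) \<in> borel_measurable M"
proof (rule borel_measurable_matrix_det)
  fix x y :: "nat \<Rightarrow> bool"
  assume "x \<in> bits {..<N}"
  then show "(\<lambda>w. constraint_matrix N c (\<phi> w) x y) \<in> borel_measurable M"
    unfolding constraint_matrix_def
    by (cases "restrict y ({..<N} - c x) = restrict x ({..<N} - c x)")
      (auto intro!: borel_measurable_cnj assms)
qed simp

lemma constraint_det_normalise:
  assumes "finite I" "matrix_det (bits {..<N}) (constraint_matrix N c (\<phi>(I := z))) \<noteq> 0"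
  shows "matrix_det (bits {..<N}) (constraint_matrix N c (\<phi>(I := normalise I z))) \<noteq> 0"
proof -
  \<comment> \<open>If the norm is 0, then \<open>z\<close> vanishes on \<open>bits I\<close>, and
    so does its normalisation because division by 0 gives 0; the factor 1 then serves. As
    \<open>s\<close> is real, it passes through the conjugation in the matrix entries.\<close>
  define s where "s = (if state_norm I z = 0 then 1 else 1 / complex_of_real (state_norm I z))"
  have s: "s \<noteq> 0" "cnj s = s" by (auto simp: s_def)
  have norm: "normalise I z b = s * z b" if "b \<in> bits I" for b
  proof (cases "state_norm I z = 0")
    case True
    then have "z b = 0"
      using that assms(1) by (auto simp: state_norm_def L2_set_eq_0_iff finite_bits)
    then show ?thesis using that by (simp add: normalise_def)
  qed (use that in \<open>simp add: normalise_def s_def\<close>)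
  have "constraint_matrix N c (\<phi>(I := normalise I z)) =
      (\<lambda>x y. (if c x = I then s else 1) * constraint_matrix N c (\<phi>(I := z)) x y)"
    by (auto simp: constraint_matrix_def norm s fun_eq_iff)
  then show ?thesis
    using assms(2) s by (simp add: matrix_det_scale_rows_eq_0_iff)
qed

text \<open>The claim is proved for Lebesgue measure on all amplitudes, starting from the good point
  \<open>\<phi> I\<close>. It then passes through normalisation, to the uniform measure on the ball,
  and to its image on the sphere.\<close>

lemma AE_haar_sphere_constraint_det:
  assumes "finite I" "\<phi> I \<in> hilb I"
    and nz: "matrix_det (bits {..<N}) (constraint_matrix N c \<phi>) \<noteq> 0"
  shows "AE z in haar_sphere I. matrix_det (bits {..<N}) (constraint_matrix N c (\<phi>(I := z))) \<noteq> 0"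
proof -
  let ?D = "\<lambda>z. matrix_det (bits {..<N}) (constraint_matrix N c (\<phi>(I := z)))"
  let ?L = "\<Pi>\<^sub>M x\<in>bits I. (lborel :: complex measure)"
  interpret product_sigma_finite "\<lambda>x::nat \<Rightarrow> bool. lborel :: complex measure"
    by unfold_locales
  have D_meas [measurable]: "?D \<in> borel_measurable (\<Pi>\<^sub>M x\<in>bits I. borel)"
  proof (rule borel_measurable_constraint_det)
    show "(\<lambda>z. (\<phi>(I := z)) (c x) b) \<in> borel_measurable (\<Pi>\<^sub>M x\<in>bits I. borel)"
      if "b \<in> bits (c x)" for x b
      using that by (cases "c x = I") auto
  qed
  have sets_L: "sets ?L = sets (\<Pi>\<^sub>M x\<in>bits I. (borel :: complex measure))"
    by (rule sets_PiM_lborel_state)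
  have D_meas_L: "?D \<in> borel_measurable ?L"
    using D_meas measurable_cong_sets[OF sets_L refl] by blast
  have "AE z in ?L. ?D z \<noteq> 0"
  proof (rule AE_PiM_coordinatewise)
    show "finite (bits I)" using assms(1) by (rule finite_bits)
    show "Measurable.pred ?L (\<lambda>z. ?D z \<noteq> 0)" using D_meas_L by measurable
    show "\<phi> I \<in> space ?L" using assms(2) by (simp add: hilb_def space_PiM)
    show "?D (\<phi> I) \<noteq> 0" using nz by simp
    fix b z assume b: "b \<in> bits I" and z: "?D z \<noteq> 0"
    \<comment> \<open>Inserting \<open>cnj w\<close> cancels the conjugation in the constraint rows:
      an entry is then either \<open>w\<close> itself or constant.\<close>
    have "\<exists>p. \<forall>w. matrix_det (bits {..<N}) (constraint_matrix N c (\<phi>(I := z(b := cnj w)))) = poly p w"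
    proof (rule matrix_det_polynomial)
      fix x y
      show "\<exists>p. \<forall>w. constraint_matrix N c (\<phi>(I := z(b := cnj w))) x y = poly p w"
      proof (cases "restrict y ({..<N} - c x) = restrict x ({..<N} - c x) \<and> c x = I \<and> restrict y I = b")
        case True
        then show ?thesis
          by (intro exI[of _ "[:0, 1:]"]) (auto simp: constraint_matrix_def)
      next
        case False
        then show ?thesis
          by (intro exI[of _ "[:constraint_matrix N c (\<phi>(I := z)) x y:]"])
            (auto simp: constraint_matrix_def)
      qed
    qed
    then obtain p where p: "\<And>w. ?D (z(b := cnj w)) = poly p w" by blast
    have p': "?D (z(b := w)) = poly p (cnj w)" for w
      using p[of "cnj w"] by simp
    \<comment> \<open>At \<open>w = z b\<close> the update does nothing, and the determinant at
      \<open>z\<close> is nonzero.\<close>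
    have "p \<noteq> 0" using z p'[of "z b"] by auto
    then show "AE w in lborel. ?D (z(b := w)) \<noteq> 0"
      unfolding p' by (rule AE_lborel_poly_cnj_nonzero)
  qed
  then have "AE z in ?L. ?D (normalise I z) \<noteq> 0"
    by (rule AE_mp) (auto intro!: AE_I2 dest: constraint_det_normalise[OF assms(1)])
  then have "AE z in uniform_measure ?L (unit_ball I). ?D (normalise I z) \<noteq> 0"
    by (intro AE_uniform_measureI unit_ball_measurable) auto
  moreover have "normalise I \<in> uniform_measure ?L (unit_ball I) \<rightarrow>\<^sub>M (\<Pi>\<^sub>M x\<in>bits I. borel)"
    using normalise_measurable[of I] by (simp add: measurable_cong_sets[OF sets_L refl])
  moreover have "{z \<in> space (\<Pi>\<^sub>M x\<in>bits I. borel). ?D z \<noteq> 0} \<in> sets (\<Pi>\<^sub>M x\<in>bits I. borel)"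
    by measurable
  ultimately show ?thesis
    unfolding haar_sphere_def by (subst AE_distr_iff)
qed

lemma measurable_haar_component:
  assumes "I \<in> K" "b \<in> bits I"
  shows "(\<lambda>\<phi>. \<phi> I b) \<in> borel_measurable (\<Pi>\<^sub>M I\<in>K. haar_sphere I)"
proof -
  have "(\<lambda>\<phi>. \<phi> I) \<in> (\<Pi>\<^sub>M I\<in>K. haar_sphere I) \<rightarrow>\<^sub>M haar_sphere I"
    using assms(1) by measurable
  then have "(\<lambda>\<phi>. \<phi> I) \<in> (\<Pi>\<^sub>M I\<in>K. haar_sphere I) \<rightarrow>\<^sub>M (\<Pi>\<^sub>M x\<in>bits I. borel)"
    by (simp add: haar_sphere_def)
  then show ?thesis
    by (rule measurable_compose) (use assms(2) in measurable)
qed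

text \<open>Redraws the vectors one edge at a time, starting from the classical instance.
  \<open>AE_haar_sphere_constraint_det\<close> handles each single redraw.\<close>

lemma AE_unsatisfiable:
  assumes "finite K" "\<And>I. I \<in> K \<Longrightarrow> finite I"
    and E: "E \<subseteq> K" "\<And>I. I \<in> E \<Longrightarrow> card I = k" "2 ^ N * (1 - 1 / 2 ^ k) ^ card E < (1::real)"
  shows "AE \<phi> in (\<Pi>\<^sub>M I\<in>K. haar_sphere I). \<not> satisfiable N (hamiltonian N E \<phi>)"
proof -
  \<comment> \<open>The product locale asks for a sigma-finite measure at every index, so indices
    outside \<open>K\<close> receive a point mass.\<close>
  define M where "M I = (if I \<in> K then haar_sphere I else return (count_space UNIV) undefined)" for I
  have PiM: "(\<Pi>\<^sub>M I\<in>K. haar_sphere I) = PiM K M"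
    by (intro PiM_cong) (auto simp: M_def)
  have "prob_space (M I)" for I
    using prob_space_haar_sphere assms(2) by (auto simp: M_def intro!: prob_space_return)
  then have "sigma_finite_measure (M I)" for I
    by (simp add: prob_space_imp_sigma_finite)
  then interpret product_sigma_finite M by (rule product_sigma_finite.intro)
  have finE: "finite E" using finite_subset[OF E(1) assms(1)] .
  obtain c a where c: "\<And>x. x \<in> bits {..<N} \<Longrightarrow> c x \<in> E"
    and nz: "matrix_det (bits {..<N}) (constraint_matrix N c (\<lambda>I b. if b = a I then 1 else 0)) \<noteq> 0"
    using exists_nonsingular_constraints[OF finE _ E(3)] E(1,2) assms(2) by blast
  let ?P = "\<lambda>\<phi>. matrix_det (bits {..<N}) (constraint_matrix N c \<phi>) \<noteq> 0"
  \<comment> \<open>The classical instance in extensional form. The space of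
    \<open>haar_sphere I\<close> is all of \<open>hilb I\<close>, so it is an admissible starting
    point.\<close>
  define \<phi>0 :: "nat set \<Rightarrow> state" where
    "\<phi>0 = (\<lambda>I\<in>K. \<lambda>b\<in>bits I. if b = a I then 1 else 0)"
  have "AE \<phi> in PiM K M. ?P \<phi>"
  proof (rule AE_PiM_coordinatewise)
    have "(\<lambda>\<phi>. matrix_det (bits {..<N}) (constraint_matrix N c \<phi>)) \<in> borel_measurable (PiM K M)"
      unfolding PiM[symmetric] using c E(1)
      by (intro borel_measurable_constraint_det measurable_haar_component) auto
    then show "Measurable.pred (PiM K M) ?P" by measurable
    show "\<phi>0 \<in> space (PiM K M)"
      by (auto simp: \<phi>0_def space_PiM M_def haar_sphere_def PiE_iff)
    have in_bits: "a I \<in> bits I" if "restrict y I = a I" for y I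
      using that by (metis restrict_in_bits)
    have "matrix_det (bits {..<N}) (constraint_matrix N c \<phi>0) =
        matrix_det (bits {..<N}) (constraint_matrix N c (\<lambda>I b. if b = a I then 1 else 0))"
      using c E(1) by (intro matrix_det_cong) (auto simp: constraint_matrix_def \<phi>0_def dest: in_bits)
    with nz show "?P \<phi>0" by simp
    fix I \<phi> assume I: "I \<in> K" "\<phi> \<in> space (PiM K M)" "?P \<phi>"
    have "\<phi> I \<in> hilb I"
      using I by (auto simp: space_PiM M_def haar_sphere_def hilb_def PiE_iff)
    then have "AE z in haar_sphere I. ?P (\<phi>(I := z))"
      using I assms(2) by (intro AE_haar_sphere_constraint_det) auto
    moreover have "M I = haar_sphere I" using I(1) by (simp add: M_def)
    ultimately show "AE z in M I. ?P (\<phi>(I := z))" by metis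
  qed fact
  then show ?thesis
    unfolding PiM
    by (rule AE_mp) (auto intro!: AE_I2 dest: unsatisfiable_if_constraint_det[OF finE c, rotated])
qed

section \<open>Measurability of unsatisfiability\<close>

lemma hamiltonian_event_measurable:
  assumes "finite K"
  shows "{w \<in> space (measure_pmf p \<Otimes>\<^sub>M (\<Pi>\<^sub>M I\<in>K. haar_sphere I)).
      \<not> satisfiable N (hamiltonian N (fst w) (snd w))}
    \<in> sets (measure_pmf p \<Otimes>\<^sub>M (\<Pi>\<^sub>M I\<in>K. haar_sphere I))"
proof -
  let ?Q = "\<Pi>\<^sub>M I\<in>K. haar_sphere I"
  let ?R = "measure_pmf p \<Otimes>\<^sub>M ?Q"
  \<comment> \<open>The type of hypergraphs is uncountable, so slicing by \<open>E\<close> is not enough. Edges outside \<open>K\<close>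
    carry the extensional value \<open>undefined\<close>, hence contribute a function of \<open>E\<close> alone.\<close>
  define H' where "H' w x y =
      (\<Sum>I\<in>K. (if I \<in> fst w \<and> finite (fst w) then 1 else 0) * projector N I (snd w I) x y) +
      (if finite (fst w) then \<Sum>I\<in>fst w - K. projector N I undefined x y else 0)"
    for w x y
  have eq: "hamiltonian N (fst w) (snd w) x y = H' w x y" if w: "w \<in> space ?R" for w x y
  \<comment> \<open>A sum over an infinite edge set is 0 by convention; the finiteness tests in
    \<open>H'\<close> reproduce this.\<close>
  proof (cases "finite (fst w)")
    case True
    have undef: "snd w I = undefined" if "I \<notin> K" for I
      using w that by (auto simp: space_pair_measure space_PiM PiE_iff extensional_def)
    have "hamiltonian N (fst w) (snd w) x y =
        (\<Sum>I\<in>fst w \<inter> K. projector N I (snd w I) x y) + (\<Sum>I\<in>fst w - K. projector N I (snd w I) x y)"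
      unfolding hamiltonian_def by (rule sum.Int_Diff[OF True])
    also have "(\<Sum>I\<in>fst w \<inter> K. projector N I (snd w I) x y) =
        (\<Sum>I\<in>K. (if I \<in> fst w then 1 else 0) * projector N I (snd w I) x y)"
      using assms by (simp add: Int_commute sum.inter_restrict if_distrib[of "\<lambda>z. z * _"] cong: if_cong)
    finally show ?thesis using True undef by (simp add: H'_def)
  qed (simp add: hamiltonian_def H'_def)
  have fst_meas: "(\<lambda>w. g (fst w)) \<in> borel_measurable ?R" for g :: "nat set set \<Rightarrow> complex"
    by (rule measurable_compose[OF measurable_fst]) simp
  have "(\<lambda>w. matrix_det (bits {..<N}) (H' w)) \<in> borel_measurable ?R"
  proof (rule borel_measurable_matrix_det)
    fix x y
    have proj: "(\<lambda>w. projector N I (snd w I) x y) \<in> borel_measurable ?R" if "I \<in> K" for I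
      unfolding projector_def tensor_op_def rank_one_def using that
      by (intro borel_measurable_times borel_measurable_cnj borel_measurable_const
        measurable_compose[OF measurable_snd measurable_haar_component]) auto
    show "(\<lambda>w. H' w x y) \<in> borel_measurable ?R"
      unfolding H'_def by (intro borel_measurable_add borel_measurable_sum borel_measurable_times proj fst_meas)
  qed simp
  then have "{w \<in> space ?R. matrix_det (bits {..<N}) (H' w) \<noteq> 0} \<in> sets ?R" by measurable
  moreover have "matrix_det (bits {..<N}) (hamiltonian N (fst w) (snd w)) = matrix_det (bits {..<N}) (H' w)"
    if "w \<in> space ?R" for w
    using eq[OF that] by (intro matrix_det_cong) auto
  ultimately show ?thesis
    by (auto simp: satisfiable_iff_matrix_det cong: conj_cong)
qed

section \<open>The number of edges\<close>

text \<open>Chernoff bound: compare the indicator with \<open>s powr (j - t)\<close>, evaluate the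
  generating function by the binomial theorem, and use 1 - x \<le> exp (- x). The parameter
  \<open>s\<close> stays free, to be chosen in the final estimate.\<close>

lemma binomial_pmf_lower_tail:
  fixes s t p :: real
  assumes p: "p \<in> {0..1}" and s: "0 < s" "s \<le> 1"
  shows "measure_pmf.prob (binomial_pmf n p) {j. real j \<le> t} \<le>
    exp (- (real n * p * (1 - s))) * s powr (- t)"
proof -
  let ?B = "binomial_pmf n p"
  have int: "integrable (measure_pmf ?B) f" for f :: "nat \<Rightarrow> real"
    using p by (intro integrable_measure_pmf_finite) auto
  have "measure_pmf.prob ?B {j. real j \<le> t} = measure_pmf.expectation ?B (indicator {j. real j \<le> t})"
    by simp
  also have "\<dots> \<le> measure_pmf.expectation ?B (\<lambda>j. s ^ j * s powr (- t))"
  proof (rule integral_mono[OF int int])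
    fix j
    have "1 \<le> s powr (real j - t)" if "real j \<le> t"
      using s that powr_mono'[of "real j - t" 0 s] by simp
    then show "indicator {j. real j \<le> t} j \<le> s ^ j * s powr (- t)"
      using s by (auto simp: indicator_def powr_diff powr_minus powr_realpow divide_simps)
  qed
  also have "\<dots> = (\<Sum>j\<le>n. real (n choose j) * (p * s) ^ j * (1 - p) ^ (n - j)) * s powr (- t)"
    using p by (simp add: expectation_binomial_pmf' sum_distrib_right power_mult_distrib mult_ac)
  also have "(\<Sum>j\<le>n. real (n choose j) * (p * s) ^ j * (1 - p) ^ (n - j)) = (1 - p * (1 - s)) ^ n"
    by (subst binomial_ring[symmetric]) (simp add: algebra_simps)
  also have "\<dots> \<le> exp (- (p * (1 - s))) ^ n"
  proof (rule power_mono)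
    have "p * (1 - s) \<le> 1 * 1" using p s by (intro mult_mono) auto
    then show "0 \<le> 1 - p * (1 - s)" by simp
    show "1 - p * (1 - s) \<le> exp (- (p * (1 - s)))" using exp_ge_add_one_self[of "- (p * (1 - s))"] by simp
  qed
  also have "\<dots> = exp (- (real n * p * (1 - s)))"
    by (simp add: exp_of_nat_mult[symmetric] mult.assoc)
  finally show ?thesis by (simp add: mult_right_mono)
qed

lemma card_k_subsets: "card (k_subsets k N) = N choose k"
  unfolding k_subsets_def by (subst n_subsets) auto

lemma map_card_random_hypergraph:
  assumes "\<alpha> * real N / real (N choose k) \<in> {0..1}"
  shows "map_pmf card (random_hypergraph k \<alpha> N) =
    binomial_pmf (N choose k) (\<alpha> * real N / real (N choose k))"
  unfolding random_hypergraph_def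
  by (subst binomial_pmf_altdef'[OF finite_k_subsets card_k_subsets assms])
    (simp add: pmf.map_comp o_def)

text \<open>The binomial coefficient is at least (N/k)^k, hence at least quadratic in
  \<open>N\<close>. Beyond this point \<open>bernoulli_pmf\<close> does not truncate.\<close>

lemma eventually_edge_probability_le_1:
  assumes "k \<ge> 2"
  shows "\<forall>\<^sub>F N in sequentially. \<alpha> * real N / real (N choose k) \<le> 1"
proof -
  have "\<forall>\<^sub>F N in sequentially. \<alpha> * real N \<le> (real N / real k)\<^sup>2"
    using assms by real_asymp
  moreover have "\<forall>\<^sub>F N in sequentially. k \<le> N" by (rule eventually_ge_at_top)
  ultimately show ?thesis
  proof eventually_elim
    case (elim N)
    have "(real N / real k)\<^sup>2 \<le> (real N / real k) ^ k"
      using elim(2) assms by (intro power_increasing) auto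
    also have "\<dots> \<le> real (N choose k)" using elim(2) by (rule binomial_ge_n_over_k_pow_k)
    finally have "\<alpha> * real N \<le> real (N choose k)" using elim(1) by simp
    moreover have "N choose k > 0" using elim(2) by (simp add: zero_less_binomial_iff)
    ultimately show ?case by simp
  qed
qed

section \<open>From the number of edges to the probability of unsatisfiability\<close>

text \<open>For each fixed hypergraph with enough edges almost all choices of vectors are
  unsatisfiable; Fubini turns this into an almost sure inclusion of events, the first of which
  depends on the hypergraph alone.\<close>

lemma prob_unsatisfiable_ge:
  "measure_pmf.prob (random_hypergraph k \<alpha> N) {E. 2 ^ N * (1 - 1 / 2 ^ k) ^ card E < (1::real)}
    \<le> \<P>((E, \<phi>) in random_instance k \<alpha> N. \<not> satisfiable N (hamiltonian N E \<phi>))"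
proof -
  let ?K = "k_subsets k N"
  let ?P = "random_hypergraph k \<alpha> N"
  let ?Q = "\<Pi>\<^sub>M I\<in>?K. haar_sphere I"
  let ?R = "random_instance k \<alpha> N"
  have R: "?R = measure_pmf ?P \<Otimes>\<^sub>M ?Q" by (simp add: random_instance_def)
  let ?A = "{E. 2 ^ N * (1 - 1 / 2 ^ k) ^ card E < (1::real)}"
  let ?U = "{w \<in> space ?R. \<not> satisfiable N (hamiltonian N (fst w) (snd w))}"
  have K: "finite I" "card I = k" if "I \<in> ?K" for I
    using that by (auto simp: k_subsets_def intro: finite_subset)
  interpret P: prob_space "measure_pmf ?P" by (rule prob_space_measure_pmf)
  interpret Q: prob_space ?Q using K(1) by (intro prob_space_PiM prob_space_haar_sphere) auto
  interpret R: prob_space ?R by (rule prob_space_random_instance)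
  interpret pair_sigma_finite "measure_pmf ?P" ?Q ..
  have U [measurable]: "?U \<in> sets ?R"
    unfolding R by (rule hamiltonian_event_measurable[OF finite_k_subsets])
  have A: "?A \<times> space ?Q \<in> sets ?R" unfolding R by (intro pair_measureI) auto
  have "AE E in measure_pmf ?P. AE \<phi> in ?Q. (E, \<phi>) \<in> ?A \<times> space ?Q \<longrightarrow> (E, \<phi>) \<in> ?U"
  proof (rule AE_pmfI)
    fix E assume "E \<in> set_pmf ?P"
    then have E: "E \<subseteq> ?K" by (auto simp: random_hypergraph_def)
    show "AE \<phi> in ?Q. (E, \<phi>) \<in> ?A \<times> space ?Q \<longrightarrow> (E, \<phi>) \<in> ?U"
    proof (cases "E \<in> ?A")
      case True
      have "AE \<phi> in ?Q. \<not> satisfiable N (hamiltonian N E \<phi>)"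
        using True E K by (intro AE_unsatisfiable[OF finite_k_subsets K(1) E(1)]) auto
      then show ?thesis
        by (rule AE_mp) (auto intro!: AE_I2 simp: R space_pair_measure)
    qed simp
  qed
  moreover have "{w \<in> space (measure_pmf ?P \<Otimes>\<^sub>M ?Q). w \<in> ?A \<times> space ?Q \<longrightarrow> w \<in> ?U}
      \<in> sets (measure_pmf ?P \<Otimes>\<^sub>M ?Q)"
    using A U unfolding R by measurable
  ultimately have AE: "AE w in ?R. w \<in> ?A \<times> space ?Q \<longrightarrow> w \<in> ?U"
    unfolding R by (intro AE_pair_measure)
  have "emeasure ?R (?A \<times> space ?Q) = emeasure (measure_pmf ?P) ?A"
    unfolding R by (subst Q.emeasure_pair_measure_Times) (auto simp: Q.emeasure_space_1)
  then have "measure_pmf.prob ?P ?A = R.prob (?A \<times> space ?Q)"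
    by (simp add: measure_def)
  also have "\<dots> \<le> R.prob ?U"
    using AE U by (rule R.finite_measure_mono_AE)
  finally show ?thesis by (simp add: case_prod_unfold)
qed

theorem mainTheorem6:
  fixes k :: nat and \<alpha> :: real
  assumes "k \<ge> 3" and "\<alpha> > - 1 / log 2 (1 - 1 / 2 ^ k)"
  shows "(\<lambda>N::nat. \<P>((E, \<phi>) in random_instance k \<alpha> N.
            \<not> satisfiable N (hamiltonian N E \<phi>))) \<longlonglongrightarrow> 1"
proof -
  define q :: real where "q = 1 - 1 / 2 ^ k"
  \<comment> \<open>The threshold density: \<open>2 ^ N * q ^ j < 1\<close> holds exactly when j
    exceeds c N.\<close>
  define c where "c = - 1 / log 2 q"
  have "(2::real) ^ k > 1" using assms(1) by (intro one_less_power) auto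
  then have q: "0 < q" "q < 1" by (auto simp: q_def)
  have log_neg: "log 2 q < 0" using q by simp
  then have c: "0 < c" "c < \<alpha>" using assms(2) by (auto simp: c_def q_def divide_simps)
  \<comment> \<open>The Chernoff parameter is the midpoint of c / \<alpha> and 1. Lying strictly
    between them makes both factors of \<open>\<delta>\<close> positive.\<close>
  define s where "s = (c / \<alpha> + 1) / 2"
  have s: "c / \<alpha> < s" "s < 1" "0 < s" using c by (auto simp: s_def field_simps)
  define \<delta> where "\<delta> = (1 - s) * (\<alpha> - c / s)"
  have "c / s < \<alpha>" using s c by (simp add: field_simps)
  then have \<delta>: "0 < \<delta>" using s by (simp add: \<delta>_def)
  have k2: "k \<ge> 2" using assms(1) by simp
  have lower: "\<forall>\<^sub>F N in sequentially. 1 - exp (- (\<delta> * real N)) \<le>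
      \<P>((E, \<phi>) in random_instance k \<alpha> N. \<not> satisfiable N (hamiltonian N E \<phi>))"
    using eventually_edge_probability_le_1[OF k2, of \<alpha>] eventually_ge_at_top[of k]
  proof eventually_elim
    case (elim N)
    let ?n = "N choose k"
    let ?p = "\<alpha> * real N / real ?n"
    let ?P = "random_hypergraph k \<alpha> N"
    let ?A = "{E. 2 ^ N * q ^ card E < (1::real)}"
    have p: "?p \<in> {0..1}" using elim c by auto
    have n: "?n > 0" using elim by (simp add: zero_less_binomial_iff)
    have few: "real j \<le> c * real N" if "\<not> 2 ^ N * q ^ j < 1" for j
    proof -
      have "1 \<le> 2 ^ N * q ^ j" using that by simp
      then have "0 \<le> log 2 (2 ^ N * q ^ j)" using q by simp
      also have "\<dots> = real N + real j * log 2 q"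
        using q by (simp add: log_mult log_nat_power)
      finally show ?thesis using log_neg by (simp add: c_def field_simps)
    qed
    have "1 - measure_pmf.prob ?P ?A = measure_pmf.prob ?P (- ?A)"
      by (subst measure_pmf.prob_compl[symmetric]) (auto simp: Compl_eq_Diff_UNIV)
    also have "\<dots> \<le> measure_pmf.prob ?P (card -` {j. real j \<le> c * real N})"
      using few by (intro measure_pmf.finite_measure_mono) auto
    also have "\<dots> = measure_pmf.prob (binomial_pmf ?n ?p) {j. real j \<le> c * real N}"
      by (simp flip: map_card_random_hypergraph[OF p])
    also have "\<dots> \<le> exp (- (real ?n * ?p * (1 - s))) * s powr (- (c * real N))"
      using s by (intro binomial_pmf_lower_tail[OF p]) auto
    \<comment> \<open>The mean \<open>?n * ?p\<close> is \<alpha> N, and the power of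
      \<open>s\<close> joins the exponent as - c N ln s.\<close>
    also have "\<dots> = exp (- (real N * (\<alpha> * (1 - s) + c * ln s)))"
      using n s by (simp add: powr_def exp_add[symmetric] algebra_simps)
    also have "\<dots> \<le> exp (- (\<delta> * real N))"
    proof -
      \<comment> \<open>This bound for the logarithm turns the exponent into the product that
        defines \<open>\<delta>\<close>.\<close>
      have "1 - 1 / s \<le> ln s" using ln_le_minus_one[of "1 / s"] s by (simp add: ln_div)
      then have "\<alpha> * (1 - s) + c * (1 - 1 / s) \<le> \<alpha> * (1 - s) + c * ln s" using c by simp
      moreover have "\<alpha> * (1 - s) + c * (1 - 1 / s) = \<delta>"
        using s by (simp add: \<delta>_def field_simps)
      ultimately have "\<delta> * real N \<le> (\<alpha> * (1 - s) + c * ln s) * real N"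
        by (intro mult_right_mono) auto
      then show ?thesis by (simp add: mult.commute)
    qed
    finally show ?case using prob_unsatisfiable_ge[where N = N and k = k and \<alpha> = \<alpha>] by (simp add: q_def)
  qed
  have lim: "(\<lambda>N. 1 - exp (- (\<delta> * real N))) \<longlonglongrightarrow> 1"
    using \<delta> by real_asymp
  have upper: "\<forall>\<^sub>F N in sequentially.
      \<P>((E, \<phi>) in random_instance k \<alpha> N. \<not> satisfiable N (hamiltonian N E \<phi>)) \<le> 1"
    by (intro always_eventually allI prob_space.prob_le_1 prob_space_random_instance)
  show ?thesis
    by (rule tendsto_sandwich[OF lower upper lim tendsto_const])
qed

end
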